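(* Let $G$ be a connected graph of order $n \ge 3$. Then $\gamma_{\rm it}^{\rm g}(G) < \frac{5}{6}n$.
   Context: All graphs are finite and simple. For a vertex set $S$, $N_G(S)$ denotes the set of vertices adjacent to at least one vertex of $S$, and $G - X$ is the graph obtained by deleting the vertices of $X$. The total isolation game on a graph $G$ is played by two players, Dominator and Staller, who alternately select vertices of $G$. If $S$ is the set of vertices selected so far, a vertex $v$ may be selected only if $v$ is adjacent to some vertex $u$ such that either $u$ belongs to a component of $G - N_G(S)$ of order at least $2$, or $u \in S$ and $u$ is an isolated vertex of $G - N_G(S)$. The game ends when no such vertex exists. Dominator aims to minimize the total number of selected vertices, Staller aims to maximize it. $\gamma_{\rm it}^{\rm g}(G)$ is the number of moves in the game in which Dominator makes the first move and both players play optimally. *)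

theory Defs
  imports Complex_Main "Graph_Theory.Graph_Theory"
begin

text \<open>
  Finite simple graphs are the symmetric loop-free digraphs without parallel arcs of the locale
  \<^locale>\<open>graph\<close>, so components are the strongly connected components \<open>sccs_verts\<close>.
\<close>

definition open_nbhd :: "('a, 'b) pre_digraph \<Rightarrow> 'a set \<Rightarrow> 'a set" where
  "open_nbhd G S = {u \<in> verts G. \<exists>v\<in>S. v \<rightarrow>\<^bsub>G\<^esub> u}"

definition delete_verts :: "('a, 'b) pre_digraph \<Rightarrow> 'a set \<Rightarrow> ('a, 'b) pre_digraph" where
  "delete_verts G X = G \<restriction> (verts G - X)"

definition isolated_in :: "('a, 'b) pre_digraph \<Rightarrow> 'a \<Rightarrow> bool" where
  "isolated_in H u \<longleftrightarrow> u \<in> verts H \<and> (\<forall>w. \<not> u \<rightarrow>\<^bsub>H\<^esub> w)"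

definition playable :: "('a, 'b) pre_digraph \<Rightarrow> 'a set \<Rightarrow> 'a set" where
  "playable G S = {v \<in> verts G. \<exists>u. v \<rightarrow>\<^bsub>G\<^esub> u \<and>
     ((\<exists>C \<in> pre_digraph.sccs_verts (delete_verts G (open_nbhd G S)). u \<in> C \<and> card C \<ge> 2)
      \<or> (u \<in> S \<and> isolated_in (delete_verts G (open_nbhd G S)) u))}"

lemma playable_subset: "playable G S \<subseteq> verts G - S"
proof
  fix v assume "v \<in> playable G S"
  then obtain u where v: "v \<in> verts G" and arc: "v \<rightarrow>\<^bsub>G\<^esub> u"
    and u: "(\<exists>C \<in> pre_digraph.sccs_verts (delete_verts G (open_nbhd G S)). u \<in> C)
            \<or> isolated_in (delete_verts G (open_nbhd G S)) u"
    by (auto simp: playable_def)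
  let ?H = "delete_verts G (open_nbhd G S)"
  have "u \<in> verts ?H"
    using u by (auto simp: isolated_in_def pre_digraph.sccs_verts_def elim: reachable_in_vertsE)
  then have "u \<in> verts G" "u \<notin> open_nbhd G S"
    by (auto simp: delete_verts_def)
  with v arc show "v \<in> verts G - S"
    by (auto simp: open_nbhd_def)
qed

datatype player = Dominator | Staller

text \<open>
  Minimax value: the number of further moves under optimal play when \<open>S\<close> is the set of vertices
  selected so far and \<open>p\<close> is to move. The finiteness guard only makes the recursion total.
\<close>

function moves_left :: "('a, 'b) pre_digraph \<Rightarrow> player \<Rightarrow> 'a set \<Rightarrow> nat" where
  "moves_left G p S =
     (if finite (verts G) \<and> playable G S \<noteq> {} then
        1 + (case p of
               Dominator \<Rightarrow> (MIN v\<in>playable G S. moves_left G Staller (insert v S))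
             | Staller \<Rightarrow> (MAX v\<in>playable G S. moves_left G Dominator (insert v S)))
      else 0)"
  by pat_completeness auto

termination
proof (relation "measure (\<lambda>(G, p, S). card (verts G - S))", goal_cases)
  case 1
  show ?case by simp
next
  case (2 G p S v)
  then have "verts G - insert v S \<subset> verts G - S" using playable_subset[of G S] by blast
  with 2 show ?case by (simp add: psubset_card_mono)
next
  case (3 G p S v)
  then have "verts G - insert v S \<subset> verts G - S" using playable_subset[of G S] by blast
  with 3 show ?case by (simp add: psubset_card_mono)
qed

declare moves_left.simps [simp del]

definition game_total_isolation_number :: "('a, 'b) pre_digraph \<Rightarrow> nat" where
  "game_total_isolation_number G = moves_left G Dominator {}"

end

theory Submission
  imports Defs
begin

text \<open>
  Call a vertex live if it is undominated and is itself selected or has an undominated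
  neighbour; the legal moves are exactly the neighbours of live vertices. No vertex ever becomes
  live again, and every move makes at least one live vertex dead. If some live vertex is not yet
  selected, Dominator has a move killing two: the middle of a path of three undominated vertices,
  or else an outside neighbour of a component \<open>K\<^sub>2\<close> of the undominated graph. Otherwise all live
  vertices are selected, so at most \<open>|S|\<close> moves remain. By induction, from a position \<open>S\<close> with
  \<open>l\<close> live vertices and Dominator to move, at most \<open>(4l + |S|)/5\<close> moves remain; this even gives
  the bound \<open>4n/5\<close>.
\<close>

text \<open>The isolation condition on selected vertices is dropped: a selected undominated vertex
  with an undominated neighbour already lies in a component of order at least 2.\<close>

definition live :: "('a, 'b) pre_digraph \<Rightarrow> 'a set \<Rightarrow> 'a set" where
  "live G S = {u \<in> verts G - open_nbhd G S.
     u \<in> S \<or> (\<exists>w \<in> verts G - open_nbhd G S. u \<rightarrow>\<^bsub>G\<^esub> w)}"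

lemma induce_subgraph_dominates:
  "u \<rightarrow>\<^bsub>G \<restriction> X\<^esub> w \<longleftrightarrow> u \<rightarrow>\<^bsub>G\<^esub> w \<and> u \<in> X \<and> w \<in> X"
  by (auto simp: arcs_ends_conv induce_subgraph_def)

context graph
begin

lemma dominates_sym: "u \<rightarrow>\<^bsub>G\<^esub> w \<Longrightarrow> w \<rightarrow>\<^bsub>G\<^esub> u"
  by (rule graph_symmetric)

lemma dominates_irrefl: "\<not> u \<rightarrow>\<^bsub>G\<^esub> u"
  using adj_not_same by blast

lemma live_subset: "live G S \<subseteq> verts G"
  by (auto simp: live_def)

lemma finite_live: "finite (live G S)"
  using live_subset finite_verts by (rule finite_subset)

text \<open>Makes the component condition local: a path to a second vertex of the component starts
  with an edge, and by symmetry the ends of an edge reach each other.\<close>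

lemma nontrivial_component_iff:
  assumes "X \<subseteq> verts G"
  shows "(\<exists>C \<in> pre_digraph.sccs_verts (G \<restriction> X). u \<in> C \<and> card C \<ge> 2)
    \<longleftrightarrow> u \<in> X \<and> (\<exists>w \<in> X. u \<rightarrow>\<^bsub>G\<^esub> w)" (is "?L \<longleftrightarrow> ?R")
proof
  assume ?L
  then obtain C where C: "C \<in> pre_digraph.sccs_verts (G \<restriction> X)" "u \<in> C" "card C \<ge> 2" by blast
  have "C \<noteq> {u}" using C(3) by auto
  then obtain w where w: "w \<in> C" "w \<noteq> u" using C(2) by blast
  have "u \<rightarrow>\<^sup>*\<^bsub>G \<restriction> X\<^esub> w" using C w by (auto simp: pre_digraph.sccs_verts_def)
  then obtain z where "u \<rightarrow>\<^bsub>G \<restriction> X\<^esub> z"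
    by (cases rule: pre_digraph.converse_reachable_cases) (use w in auto)
  then show ?R by (auto simp: induce_subgraph_dominates)
next
  assume ?R
  then obtain w where w: "u \<in> X" "w \<in> X" "u \<rightarrow>\<^bsub>G\<^esub> w" by blast
  let ?H = "G \<restriction> X"
  interpret H: wf_digraph ?H by (rule wellformed_induce_subgraph)
  define C where "C = H.scc_of u"
  have uw: "u \<rightarrow>\<^sup>*\<^bsub>?H\<^esub> w" "w \<rightarrow>\<^sup>*\<^bsub>?H\<^esub> u" "u \<rightarrow>\<^sup>*\<^bsub>?H\<^esub> u"
    using w dominates_sym by (auto simp: induce_subgraph_dominates intro!: H.reachable_adjI)
  have sub: "{u, w} \<subseteq> C" using uw by (auto simp: C_def H.scc_of_def)
  have "C \<subseteq> X" using H.reachable_in_verts(2) by (auto simp: C_def H.scc_of_def)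
  then have "finite C" using assms finite_verts finite_subset by metis
  with sub have "card {u, w} \<le> card C" by (intro card_mono)
  moreover have "u \<noteq> w" using w dominates_irrefl by auto
  ultimately have "card C \<ge> 2" by simp
  moreover have "C \<in> H.sccs_verts"
    unfolding H.in_sccs_verts_conv_reachable C_def H.scc_of_def
    using uw by (blast intro: H.reachable_trans)
  ultimately show ?L using sub by blast
qed

lemma playable_eq: "playable G S = {v \<in> verts G. \<exists>u \<in> live G S. v \<rightarrow>\<^bsub>G\<^esub> u}"
proof -
  let ?U = "verts G - open_nbhd G S"
  have "(\<exists>C \<in> pre_digraph.sccs_verts (G \<restriction> ?U). u \<in> C \<and> card C \<ge> 2)
      \<or> (u \<in> S \<and> isolated_in (G \<restriction> ?U) u) \<longleftrightarrow> u \<in> live G S" for u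
    by (subst nontrivial_component_iff)
      (auto simp: live_def isolated_in_def induce_subgraph_dominates)
  then show ?thesis by (auto simp: playable_def delete_verts_def)
qed

text \<open>Selecting \<open>v\<close> only enlarges the dominated set, so \<open>v\<close> itself
  is the only candidate for a new live vertex. As \<open>v\<close> has an undominated neighbour, it
  was live already if undominated.\<close>

lemma live_insert_subset:
  assumes "v \<in> playable G S"
  shows "live G (insert v S) \<subseteq> live G S"
proof -
  have "v \<in> live G S" if "v \<in> verts G - open_nbhd G S"
    using assms that by (auto simp: playable_eq live_def)
  then show ?thesis by (auto simp: live_def open_nbhd_def)
qed

lemma card_live_insert:
  assumes "v \<in> playable G S" "T \<subseteq> live G S" "T \<inter> live G (insert v S) = {}"
  shows "card (live G (insert v S)) + card T \<le> card (live G S)"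
proof -
  have "card (live G (insert v S) \<union> T) \<le> card (live G S)"
    using assms live_insert_subset by (intro card_mono finite_live) auto
  then show ?thesis
    using assms finite_live finite_subset by (subst card_Un_disjoint[symmetric]) blast+
qed

lemma card_live_insert_less:
  assumes "v \<in> playable G S"
  shows "card (live G (insert v S)) < card (live G S)"
proof -
  obtain u where u: "u \<in> live G S" "v \<rightarrow>\<^bsub>G\<^esub> u" using assms by (auto simp: playable_eq)
  then have "u \<notin> live G (insert v S)" by (auto simp: live_def open_nbhd_def)
  then show ?thesis using card_live_insert[OF assms, of "{u}"] u by simp
qed

lemma crossing_edge:
  assumes "strongly_connected G" "A \<subseteq> verts G" "A \<noteq> {}" "A \<noteq> verts G"
  obtains x y where "x \<in> A" "y \<in> verts G - A" "x \<rightarrow>\<^bsub>G\<^esub> y"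
proof -
  obtain a b where ab: "a \<in> A" "b \<in> verts G - A" using assms by blast
  then have "a \<rightarrow>\<^sup>*\<^bsub>G\<^esub> b" using assms by (auto simp: strongly_connected_def)
  \<comment> \<open>Without a crossing edge, a walk that starts in \<open>A\<close> could never
    leave it.\<close>
  then have "b \<notin> A \<longrightarrow> (\<exists>x \<in> A. \<exists>y \<in> verts G - A. x \<rightarrow>\<^bsub>G\<^esub> y)"
    by (induction rule: reachable_induct) (use ab adj_in_verts(2) in blast)+
  then show ?thesis using ab that by blast
qed

lemma exists_move_killing_two:
  assumes conn: "strongly_connected G" and n: "card (verts G) \<ge> 3"
    and u: "u \<in> live G S" "u \<notin> S"
  obtains v where "v \<in> playable G S" "card (live G (insert v S)) + 2 \<le> card (live G S)"
proof -
  let ?U = "verts G - open_nbhd G S"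
  have kill: thesis
    if "v \<in> playable G S" "a \<in> live G S" "b \<in> live G S" "a \<noteq> b"
      "a \<notin> live G (insert v S)" "b \<notin> live G (insert v S)" for v a b
    using that(1) card_live_insert[of v S "{a, b}"] that(2-) by (intro \<open>\<And>v. _ \<Longrightarrow> _ \<Longrightarrow> thesis\<close>) auto
  obtain w where w: "w \<in> ?U" "u \<rightarrow>\<^bsub>G\<^esub> w" and uU: "u \<in> ?U"
    using u by (auto simp: live_def)
  have wu: "w \<rightarrow>\<^bsub>G\<^esub> u" using w dominates_sym by blast
  \<comment> \<open>A selected neighbour would dominate \<open>u\<close>.\<close>
  have wS: "w \<notin> S" using uU wu by (auto simp: open_nbhd_def)
  have lw: "w \<in> live G S" using w wu uU by (auto simp: live_def)
  have path: thesis
    if "a \<in> ?U" "b \<in> ?U" "c \<in> ?U" "a \<noteq> c" "b \<rightarrow>\<^bsub>G\<^esub> a" "b \<rightarrow>\<^bsub>G\<^esub> c" for a b c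
  proof (rule kill)
    show "a \<in> live G S" "c \<in> live G S"
      using that dominates_sym by (auto simp: live_def)
    then show "b \<in> playable G S" using that by (auto simp: playable_eq)
    show "a \<notin> live G (insert b S)" "c \<notin> live G (insert b S)"
      using that by (auto simp: live_def open_nbhd_def)
  qed fact
  \<comment> \<open>Either \<open>b\<close> is the middle of an undominated path, or
    \<open>a\<close> is its only undominated neighbour; then dominating \<open>a\<close> by
    \<open>y\<close> also kills \<open>b\<close>. Here \<open>y \<noteq> b\<close> keeps
    \<open>b\<close> unselected, as a selected undominated vertex is live.\<close>
  have outside: thesis
    if "a \<in> ?U" "b \<in> ?U" "a \<notin> S" "b \<notin> S" "a \<rightarrow>\<^bsub>G\<^esub> b" "y \<in> verts G" "y \<noteq> b" "a \<rightarrow>\<^bsub>G\<^esub> y" for a b y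
  proof (cases "\<exists>c \<in> ?U. c \<noteq> a \<and> b \<rightarrow>\<^bsub>G\<^esub> c")
    case True
    then show ?thesis using path[of a b] that dominates_sym by blast
  next
    case False
    have "y \<rightarrow>\<^bsub>G\<^esub> a" using that dominates_sym by blast
    show ?thesis
    proof (rule kill)
      show "a \<in> live G S" "b \<in> live G S" using that dominates_sym by (auto simp: live_def)
      then show "y \<in> playable G S" using that \<open>y \<rightarrow>\<^bsub>G\<^esub> a\<close> by (auto simp: playable_eq)
      show "a \<noteq> b" using that dominates_irrefl by blast
      show "a \<notin> live G (insert y S)" using \<open>y \<rightarrow>\<^bsub>G\<^esub> a\<close> by (auto simp: live_def open_nbhd_def)
      show "b \<notin> live G (insert y S)"
        using False that \<open>y \<rightarrow>\<^bsub>G\<^esub> a\<close> by (auto simp: live_def open_nbhd_def)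
    qed
  qed
  \<comment> \<open>A third vertex and connectedness give an edge leaving the pair, whose outer end
    serves as \<open>y\<close> in \<open>outside\<close>.\<close>
  have "{u, w} \<noteq> verts G"
    using n card_insert_le_m1[of 2 "{w}" u] by auto
  moreover have "{u, w} \<subseteq> verts G" "{u, w} \<noteq> {}" using uU w by auto
  ultimately obtain x y where y: "x \<in> {u, w}" "y \<in> verts G - {u, w}" "x \<rightarrow>\<^bsub>G\<^esub> y"
    using crossing_edge[OF conn, of "{u, w}"] by metis
  then consider "x = u" | "x = w" by blast
  then show ?thesis
  proof cases
    case 1
    then show ?thesis using outside[OF uU w(1) u(2) wS w(2), of y] y by simp
  next
    case 2
    then show ?thesis using outside[OF w(1) uU wS u(2) wu, of y] y by simp
  qed
qed

lemma finite_playable: "finite (playable G S)"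
  using finite_verts by (rule rev_finite_subset) (auto simp: playable_eq)

lemma moves_left_Dominator_le:
  "v \<in> playable G S \<Longrightarrow> moves_left G Dominator S \<le> 1 + moves_left G Staller (insert v S)"
  using finite_playable by (subst moves_left.simps) (auto intro!: Min_le)

lemma moves_left_Staller_obtain:
  assumes "playable G S \<noteq> {}"
  obtains v where "v \<in> playable G S"
    "moves_left G Staller S = 1 + moves_left G Dominator (insert v S)"
proof -
  let ?M = "(\<lambda>v. moves_left G Dominator (insert v S)) ` playable G S"
  have "finite ?M" using finite_playable by blast
  then have "Max ?M \<in> ?M" using assms by (intro Max_in) auto
  moreover have "moves_left G Staller S = 1 + Max ?M"
    using assms by (subst moves_left.simps) auto
  ultimately show ?thesis using that by auto
qed

lemma moves_left_eq_0: "playable G S = {} \<Longrightarrow> moves_left G p S = 0"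
  by (simp add: moves_left.simps)

lemma moves_left_le_card_live: "moves_left G p S \<le> card (live G S)"
proof (induction "card (live G S)" arbitrary: p S rule: less_induct)
  case less
  show ?case
  proof (cases "playable G S = {}")
    case True
    then show ?thesis by (simp add: moves_left_eq_0)
  next
    case False
    \<comment> \<open>One inequality covers both players: any move bounds the minimum from above,
      and an optimal move attains the maximum.\<close>
    obtain v q where v: "v \<in> playable G S" "moves_left G p S \<le> 1 + moves_left G q (insert v S)"
    proof (cases p)
      case Dominator
      obtain v where "v \<in> playable G S" using False by blast
      then show ?thesis using that[of v Staller] moves_left_Dominator_le[of v S] Dominator by simp
    next
      case Staller
      obtain v where "v \<in> playable G S"
        "moves_left G Staller S = 1 + moves_left G Dominator (insert v S)"
        using False by (rule moves_left_Staller_obtain)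
      then show ?thesis using that[of v Dominator] Staller by simp
    qed
    then show ?thesis using less[of "insert v S" q] card_live_insert_less[OF v(1)] by linarith
  qed
qed

text \<open>The weights balance over a full round: at least three live vertices die and
  \<open>S\<close> gains at most two vertices, so the right side drops by at least 4 * 3 - 2 = 10,
  which pays for two moves.\<close>

lemma moves_left_Dominator_bound:
  assumes conn: "strongly_connected G" and n: "card (verts G) \<ge> 3" and "finite S"
  shows "5 * moves_left G Dominator S \<le> 4 * card (live G S) + card S"
  using \<open>finite S\<close>
proof (induction "card (live G S)" arbitrary: S rule: less_induct)
  case less
  show ?case
  proof (cases "live G S \<subseteq> S")
    case True
    \<comment> \<open>With l live vertices and l \<le> |S|, the trivial bound l on the moves
      suffices, since 5l \<le> 4l + |S|.\<close>
    then have "card (live G S) \<le> card S" using less.prems by (rule card_mono[rotated])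
    then show ?thesis using moves_left_le_card_live[of Dominator S] by linarith
  next
    case False
    then obtain v where v: "v \<in> playable G S"
      and drop: "card (live G (insert v S)) + 2 \<le> card (live G S)"
      using exists_move_killing_two[OF conn n] by blast
    note D = moves_left_Dominator_le[OF v]
    show ?thesis
    proof (cases "playable G (insert v S) = {}")
      case True
      \<comment> \<open>The single remaining move costs 5, and the two vertices it kills pay
        8.\<close>
      then show ?thesis using D drop by (simp add: moves_left_eq_0)
    next
      case False
      then obtain w where w: "w \<in> playable G (insert v S)"
        and St: "moves_left G Staller (insert v S) = 1 + moves_left G Dominator (insert w (insert v S))"
        by (rule moves_left_Staller_obtain)
      note less_w = card_live_insert_less[OF w]
      have "card (insert w (insert v S)) \<le> card S + 2"
        using less.prems by (simp add: card_insert_if)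
      moreover have "5 * moves_left G Dominator (insert w (insert v S))
          \<le> 4 * card (live G (insert w (insert v S))) + card (insert w (insert v S))"
        using less drop less_w by (intro less.hyps) auto
      ultimately show ?thesis using D St drop less_w by linarith
    qed
  qed
qed

end

theorem theorem4p1:
  fixes G :: "('a, 'b) pre_digraph"
  assumes "graph G"
    and "Digraph_Component.connected G"
    and "card (verts G) \<ge> 3"
  shows "real (game_total_isolation_number G) < 5 / 6 * real (card (verts G))"
proof -
  interpret graph G by fact
  have "strongly_connected G"
    using sym_arcs assms(2) by (rule symmetric_connected_imp_strongly_connected)
  then have "5 * moves_left G Dominator {} \<le> 4 * card (live G {})"
    using moves_left_Dominator_bound[of "{}"] assms(3) by simp
  also have "\<dots> \<le> 4 * card (verts G)"
    using card_mono[OF finite_verts live_subset] by simp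
  \<comment> \<open>Strictness comes from 4/5 < 5/6 and n > 0.\<close>
  finally show ?thesis
    using assms(3) by (simp add: game_total_isolation_number_def)
qed

end
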